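(* Let $(X,d)$ be a distance space, and let $\tau(p,\sigma;x,y,z;d)$ be the power triangle function on $(X,d)$, with $\sigma\in\mathbb{R}^+$ and $x,y,z\in X$. Then $$\tau(p,\sigma;x,y,z;d)=\begin{cases} 2\sigma\max\{d(x,z),d(z,y)\} & \text{for } p=\infty \text{ (maximum; corresponds to inframetric space)},\\ 2\sigma\left[\tfrac12 d^2(x,z)+\tfrac12 d^2(z,y)\right]^{1/2} & \text{for } p=2 \text{ (quadratic mean)},\\ \sigma\,[d(x,z)+d(z,y)] & \text{for } p=1 \text{ (arithmetic mean; corresponds to near metric space)},\\ 2\sigma\sqrt{d(x,z)}\sqrt{d(z,y)} & \text{for } p=0 \text{ (geometric mean)},\\ 4\sigma\left[\frac{1}{d(x,z)}+\frac{1}{d(z,y)}\right]^{-1} & \text{for } p=-1 \text{ (harmonic mean)},\\ 2\sigma\min\{d(x,z),d(z,y)\} & \text{for } p=-\infty \text{ (minimum)}. \end{cases}$$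
   Context: A distance on a set $X$ is a function $d:X\times X\to\mathbb{R}$ such that for all $x,y\in X$: $d(x,y)\ge 0$; $d(x,y)=0\iff x=y$; $d(x,y)=d(y,x)$ (no triangle inequality is assumed). The pair $(X,d)$ is then a distance space. $\mathbb{R}^+$ is the set of positive reals and $\mathbb{R}^*=\mathbb{R}\cup\{-\infty,\infty\}$. The power triangle function on $(X,d)$ is $$\tau(p,\sigma;x,y,z;d)=2\sigma\left[\tfrac12 d^p(x,z)+\tfrac12 d^p(z,y)\right]^{1/p},\qquad (p,\sigma)\in\mathbb{R}^*\times\mathbb{R}^+,\ x,y,z\in X,$$ where for $p\in\{\infty,0,-\infty\}$ the right-hand side denotes the limit of the expression as the (real, nonzero) exponent tends to $p$. The names of spaces in the claim are only descriptive: a distance space is an inframetric space if $d(x,y)\le\tau(\infty,\tfrac12;x,y,z;d)$ for all $x,y,z\in X$, and a near metric space if $d(x,y)\le\tau(1,\sigma;x,y,z;d)$ for all $x,y,z\in X$. *)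

theory Defs
  imports "HOL-Analysis.Analysis"
begin

text \<open>
  A distance is required to satisfy no triangle inequality, so the metric space
  classes and locales of the library do not apply.
\<close>

locale distance_space =
  fixes X :: "'a set" and d :: "'a \<Rightarrow> 'a \<Rightarrow> real"
  assumes nonneg: "\<lbrakk>x \<in> X; y \<in> X\<rbrakk> \<Longrightarrow> 0 \<le> d x y"
    and zero_iff: "\<lbrakk>x \<in> X; y \<in> X\<rbrakk> \<Longrightarrow> d x y = 0 \<longleftrightarrow> x = y"
    and sym: "\<lbrakk>x \<in> X; y \<in> X\<rbrakk> \<Longrightarrow> d x y = d y x"

text \<open>
  The points of a distance space may coincide, so for a negative exponent the power mean
  involves negative powers of \<open>0\<close>. The real-valued \<^const>\<open>powr\<close> has \<open>0 powr p = 0\<close>, which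
  would make \<open>0\<close> act as a neutral element of the means of negative exponent. Powers are
  therefore taken in \<open>[0, \<infinity>]\<close> by continuous extension:
  \<open>0\<^sup>p = \<infinity>\<close> and \<open>\<infinity>\<^sup>p = 0\<close> for \<open>p < 0\<close>, and \<open>0\<^sup>p = 0\<close> and \<open>\<infinity>\<^sup>p = \<infinity>\<close> for \<open>p > 0\<close>.
\<close>

definition ennreal_powr :: "ennreal \<Rightarrow> real \<Rightarrow> ennreal" where
  "ennreal_powr a p =
     (if p = 0 then 1
      else if a = 0 then (if p < 0 then top else 0)
      else if a = top then (if p < 0 then 0 else top)
      else ennreal (enn2real a powr p))"

lemma ennreal_powr_ennreal: "0 < a \<Longrightarrow> ennreal_powr (ennreal a) p = ennreal (a powr p)"
  by (auto simp: ennreal_powr_def)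

text \<open>The power triangle function at a nonzero real exponent.\<close>

definition power_triangle_real ::
    "real \<Rightarrow> real \<Rightarrow> 'a \<Rightarrow> 'a \<Rightarrow> 'a \<Rightarrow> ('a \<Rightarrow> 'a \<Rightarrow> real) \<Rightarrow> ennreal" where
  "power_triangle_real p \<sigma> x y z d =
     ennreal (2 * \<sigma>) *
       ennreal_powr (1 / 2 * ennreal_powr (ennreal (d x z)) p
                   + 1 / 2 * ennreal_powr (ennreal (d z y)) p) (1 / p)"

definition power_triangle ::
    "ereal \<Rightarrow> real \<Rightarrow> 'a \<Rightarrow> 'a \<Rightarrow> 'a \<Rightarrow> ('a \<Rightarrow> 'a \<Rightarrow> real) \<Rightarrow> ennreal" where
  "power_triangle p \<sigma> x y z d =
     (case p of
        ereal r \<Rightarrow> if r = 0 then Lim (at 0) (\<lambda>q. power_triangle_real q \<sigma> x y z d)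
                   else power_triangle_real r \<sigma> x y z d
      | PInfty \<Rightarrow> Lim at_top (\<lambda>q. power_triangle_real q \<sigma> x y z d)
      | MInfty \<Rightarrow> Lim at_bot (\<lambda>q. power_triangle_real q \<sigma> x y z d))"

text \<open>
  For positive distances and a nonzero real exponent, the values agree with the
  expression computed in the reals.
\<close>

lemma power_triangle_eq_real:
  assumes "p \<noteq> 0" "0 \<le> \<sigma>" "0 < d x z" "0 < d z y"
  shows "power_triangle (ereal p) \<sigma> x y z d =
    ennreal (2 * \<sigma> * (1 / 2 * d x z powr p + 1 / 2 * d z y powr p) powr (1 / p))"
proof -
  have half: "(1 / 2 :: ennreal) = ennreal (1 / 2)"
    using divide_ennreal[of 1 2] by simp
  have "0 < 1 / 2 * d x z powr p + 1 / 2 * d z y powr p"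
    using assms by (simp add: add_pos_pos)
  moreover have "1 / 2 * ennreal (d x z powr p) + 1 / 2 * ennreal (d z y powr p)
      = ennreal (1 / 2 * d x z powr p + 1 / 2 * d z y powr p)"
    unfolding half by (simp only: ennreal_mult[symmetric] ennreal_plus[symmetric]
        powr_ge_zero zero_le_divide_1_iff mult_nonneg_nonneg zero_le_numeral)
  ultimately show ?thesis
    using assms
    by (simp only: power_triangle_def power_triangle_real_def ereal.case if_False
        ennreal_powr_ennreal) (simp add: ennreal_mult)
qed

end

theory Submission
  imports Defs "HOL-Real_Asymp.Real_Asymp"
begin

text \<open>
  At a nonzero real exponent the mean is an ordinary real power mean, except that it vanishes
  when the exponent is negative and one of the distances is \<open>0\<close>. The limit at \<open>\<infinity>\<close> follows from
  squeezing the mean between \<open>(1/2)\<^sup>1\<^sup>/\<^sup>p max a b\<close> and \<open>max a b\<close>, and the limit at \<open>-\<infinity>\<close> by passing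
  to reciprocals. For positive distances the limit at \<open>0\<close> is the exponential of the derivative
  at \<open>0\<close> of the logarithm of \<open>(a\<^sup>p + b\<^sup>p)/2\<close>; if a distance is \<open>0\<close>, the factor \<open>(1/2)\<^sup>1\<^sup>/\<^sup>p\<close>
  forces the limit \<open>0\<close>.
\<close>

text \<open>The separate case encodes 0^p = \<infinity> for p < 0: since
  \<open>0 powr p = 0\<close>, the formula alone would drop the term of a zero distance instead of
  letting it force the mean to 0.\<close>

definition power_mean :: "real \<Rightarrow> real \<Rightarrow> real \<Rightarrow> real" where
  "power_mean p a b =
     (if p < 0 \<and> (a = 0 \<or> b = 0) then 0
      else (1 / 2 * a powr p + 1 / 2 * b powr p) powr (1 / p))"

lemma power_mean_commute: "power_mean p a b = power_mean p b a"
  by (auto simp: power_mean_def add.commute)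

lemma half_ennreal: "(1 / 2 :: ennreal) = ennreal (1 / 2)"
  using divide_ennreal[of 1 2] by simp

lemma ennreal_powr_ennreal_nonneg:
  assumes "0 \<le> a" "p \<noteq> 0" "0 < p \<or> a \<noteq> 0"
  shows "ennreal_powr (ennreal a) p = ennreal (a powr p)"
  using assms by (auto simp: ennreal_powr_def)

lemma ennreal_powr_zero_neg: "p < 0 \<Longrightarrow> ennreal_powr 0 p = top"
  by (simp add: ennreal_powr_def)

lemma ennreal_powr_top_neg: "p < 0 \<Longrightarrow> ennreal_powr top p = 0"
  by (simp add: ennreal_powr_def)

text \<open>For p < 0 a zero distance makes the inner sum \<open>top\<close>, whose power with
  exponent 1/p < 0 is 0. In every other case all powers are finite and can be computed in the
  reals.\<close>

lemma power_triangle_real_eq: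
  assumes "p \<noteq> 0" "0 \<le> \<sigma>" "0 \<le> d x z" "0 \<le> d z y"
  shows "power_triangle_real p \<sigma> x y z d = ennreal (2 * \<sigma> * power_mean p (d x z) (d z y))"
proof (cases "p < 0 \<and> (d x z = 0 \<or> d z y = 0)")
  case True
  have "1 / 2 * ennreal_powr (ennreal (d x z)) p + 1 / 2 * ennreal_powr (ennreal (d z y)) p = top"
    using True by (auto simp: ennreal_powr_zero_neg half_ennreal ennreal_mult_top)
  with True show ?thesis
    unfolding power_triangle_real_def
    by (simp only:) (auto simp: power_mean_def ennreal_powr_top_neg)
next
  case False
  let ?s = "1 / 2 * d x z powr p + 1 / 2 * d z y powr p"
  have "0 \<le> ?s" by simp
  have s: "1 / 2 * ennreal_powr (ennreal (d x z)) p + 1 / 2 * ennreal_powr (ennreal (d z y)) p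
      = ennreal ?s"
  proof -
    have "ennreal_powr (ennreal (d x z)) p = ennreal (d x z powr p)"
      "ennreal_powr (ennreal (d z y)) p = ennreal (d z y powr p)"
      using False assms by (auto intro!: ennreal_powr_ennreal_nonneg)
    then show ?thesis
      unfolding half_ennreal by (simp only: ennreal_mult[symmetric] ennreal_plus[symmetric]
        powr_ge_zero zero_le_divide_1_iff mult_nonneg_nonneg zero_le_numeral)
  qed
  \<comment> \<open>The outer power is finite as well: if p < 0, both distances are positive here,
    so the sum is nonzero.\<close>
  have "0 < 1 / p \<or> ?s \<noteq> 0"
    using False assms by (auto simp: add_nonneg_eq_0_iff)
  then have "ennreal_powr (ennreal ?s) (1 / p) = ennreal (?s powr (1 / p))"
    using \<open>0 \<le> ?s\<close> assms by (intro ennreal_powr_ennreal_nonneg) auto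
  with False assms show ?thesis
    unfolding power_triangle_real_def s by (auto simp: power_mean_def ennreal_mult)
qed

text \<open>With m the larger number, one term of the half sum is m^p/2 and the other lies between 0
  and m^p/2. So the half sum lies between m^p/2 and m^p, and for p > 0 the power 1/p is
  increasing.\<close>

lemma power_mean_bounds:
  assumes "0 < p" "0 \<le> a" "0 \<le> b"
  shows "max a b * (1 / 2) powr (1 / p) \<le> power_mean p a b" "power_mean p a b \<le> max a b"
proof -
  let ?m = "max a b" and ?s = "1 / 2 * a powr p + 1 / 2 * b powr p"
  have m: "(?m powr p) powr (1 / p) = ?m"
    using assms by (simp add: powr_powr)
  have le: "a powr p \<le> ?m powr p" "b powr p \<le> ?m powr p"
    using assms by (auto intro!: powr_mono2)
  have ge: "?m powr p \<le> a powr p + b powr p"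
    by (cases "a \<le> b") (auto simp: max_def)
  have "?m * (1 / 2) powr (1 / p) = (?m powr p * (1 / 2)) powr (1 / p)"
    using m by (simp only: powr_mult)
  also have "\<dots> \<le> ?s powr (1 / p)"
    using assms ge by (intro powr_mono2) auto
  finally show "?m * (1 / 2) powr (1 / p) \<le> power_mean p a b"
    using assms by (simp add: power_mean_def)
  have "?s powr (1 / p) \<le> (?m powr p) powr (1 / p)"
    using assms le by (intro powr_mono2) auto
  then show "power_mean p a b \<le> ?m"
    using assms by (simp only: m power_mean_def) simp
qed

lemma power_mean_at_top:
  assumes "0 \<le> a" "0 \<le> b"
  shows "((\<lambda>p. power_mean p a b) \<longlongrightarrow> max a b) at_top"
proof (rule real_tendsto_sandwich)
  show "eventually (\<lambda>p. max a b * (1 / 2) powr (1 / p) \<le> power_mean p a b) at_top"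
    using eventually_gt_at_top[of 0] by eventually_elim (use assms power_mean_bounds in auto)
  show "eventually (\<lambda>p. power_mean p a b \<le> max a b) at_top"
    using eventually_gt_at_top[of 0] by eventually_elim (use assms power_mean_bounds in auto)
  have "((\<lambda>p::real. (1 / 2 :: real) powr (1 / p)) \<longlongrightarrow> 1) at_top"
    by real_asymp
  from tendsto_mult_left[OF this, of "max a b"]
  show "((\<lambda>p. max a b * (1 / 2) powr (1 / p)) \<longlongrightarrow> max a b) at_top"
    by simp
qed simp

text \<open>For c > 0, c^(-p) = (1/c)^p rewrites the inner powers, and the outer exponent 1/(-p)
  inverts the result.\<close>

lemma power_mean_uminus:
  assumes "0 < a" "0 < b"
  shows "power_mean (- p) a b = inverse (power_mean p (inverse a) (inverse b))"
proof -
  have inv: "c powr - p = inverse c powr p" if "0 < c" for c :: real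
    using that by (metis powr_minus inverse_powr less_imp_le)
  have exponent: "c powr (1 / - p) = inverse (c powr (1 / p))" for c :: real
    by (metis minus_divide_right powr_minus)
  show ?thesis
    unfolding power_mean_def inv[OF assms(1)] inv[OF assms(2)] exponent
    using assms by simp
qed

lemma power_mean_at_bot:
  assumes "0 \<le> a" "0 \<le> b"
  shows "((\<lambda>p. power_mean p a b) \<longlongrightarrow> min a b) at_bot"
proof (cases "a = 0 \<or> b = 0")
  case True
  then have "min a b = 0"
    using assms by auto
  moreover have "eventually (\<lambda>p. power_mean p a b = 0) at_bot"
    using eventually_gt_at_bot[of 0] by eventually_elim (use True in \<open>auto simp: power_mean_def\<close>)
  ultimately show ?thesis
    by (simp add: tendsto_eventually)
next
  case False
  with assms have pos: "0 < a" "0 < b" by auto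
  have "((\<lambda>p. power_mean p (inverse a) (inverse b)) \<longlongrightarrow> max (inverse a) (inverse b)) at_top"
    using pos by (intro power_mean_at_top) auto
  \<comment> \<open>The limit is positive, so inversion is continuous there.\<close>
  then have "((\<lambda>p. inverse (power_mean p (inverse a) (inverse b)))
      \<longlongrightarrow> inverse (max (inverse a) (inverse b))) at_top"
    using pos by (intro tendsto_inverse) (auto simp: max_def)
  moreover have "inverse (max (inverse a) (inverse b)) = min a b"
    using pos by (auto simp: max_def min_def)
  ultimately show ?thesis
    using pos by (simp add: filterlim_at_bot_mirror power_mean_uminus)
qed

lemma power_mean_at_0_pos:
  assumes "0 < a" "0 < b"
  shows "((\<lambda>p. power_mean p a b) \<longlongrightarrow> sqrt a * sqrt b) (at 0)"
proof -
  let ?s = "\<lambda>p. 1 / 2 * a powr p + 1 / 2 * b powr p"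
  have s: "0 < ?s p" for p
    using assms by (simp add: add_pos_pos)
  have "((\<lambda>p. ln (?s p)) has_real_derivative (ln a + ln b) / 2) (at 0)"
    using assms s[of 0] by (auto intro!: derivative_eq_intros simp: field_simps)
  \<comment> \<open>Since \<open>?s 0 = 1\<close> has logarithm 0, \<open>ln (?s p) / p\<close> is
    the difference quotient at 0.\<close>
  then have "((\<lambda>p. ln (?s p) / p) \<longlongrightarrow> (ln a + ln b) / 2) (at 0)"
    using assms by (simp add: has_field_derivative_iff)
  then have "((\<lambda>p. exp (ln (?s p) / p)) \<longlongrightarrow> exp ((ln a + ln b) / 2)) (at 0)"
    by (rule tendsto_exp)
  moreover have "exp ((ln a + ln b) / 2) = sqrt a * sqrt b"
    using assms by (simp add: powr_half_sqrt[symmetric] powr_def exp_add[symmetric] add_divide_distrib)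
  \<comment> \<open>This holds at p = 0 too: division by 0 gives 0, and both sides are 1.\<close>
  moreover have "power_mean p a b = exp (ln (?s p) / p)" for p
    using assms s[of p] by (simp add: power_mean_def powr_def)
  ultimately show ?thesis by simp
qed

text \<open>The two sides differ: for p < 0 the mean is 0 by convention, while for p > 0 it equals
  (1/2)^(1/p) * b, where 1/p tends to \<infinity>.\<close>

lemma power_mean_zero_at_0:
  assumes "0 \<le> b"
  shows "((\<lambda>p. power_mean p 0 b) \<longlongrightarrow> 0) (at 0)"
proof (rule filterlim_split_at)
  have "eventually (\<lambda>p. power_mean p 0 b = 0) (at_left 0)"
    by (auto simp: eventually_at_filter power_mean_def)
  then show "((\<lambda>p. power_mean p 0 b) \<longlongrightarrow> 0) (at_left 0)"
    by (rule tendsto_eventually)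
  have "((\<lambda>p::real. (1 / 2 :: real) powr (1 / p)) \<longlongrightarrow> 0) (at_right 0)"
    by real_asymp
  from tendsto_mult_right[OF this, of b]
  have "((\<lambda>p. (1 / 2) powr (1 / p) * b) \<longlongrightarrow> 0) (at_right 0)"
    by simp
  moreover have "eventually (\<lambda>p. (1 / 2) powr (1 / p) * b = power_mean p 0 b) (at_right 0)"
    using eventually_at_right_less[of 0]
  proof eventually_elim
    case (elim p)
    then have "power_mean p 0 b = (1 / 2 * b powr p) powr (1 / p)"
      by (simp add: power_mean_def)
    also have "\<dots> = (1 / 2) powr (1 / p) * b"
      using elim assms by (subst powr_mult) (simp add: powr_powr)
    finally show ?case by simp
  qed
  ultimately show "((\<lambda>p. power_mean p 0 b) \<longlongrightarrow> 0) (at_right 0)"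
    by (rule Lim_transform_eventually)
qed

lemma power_mean_at_0:
  assumes "0 \<le> a" "0 \<le> b"
  shows "((\<lambda>p. power_mean p a b) \<longlongrightarrow> sqrt a * sqrt b) (at 0)"
proof -
  consider "a = 0" | "b = 0" | "0 < a" "0 < b"
    using assms by linarith
  then show ?thesis
  proof cases
    case 1
    then show ?thesis using power_mean_zero_at_0[of b] assms by simp
  next
    case 2
    then show ?thesis
      using power_mean_zero_at_0[of a] assms by (simp add: power_mean_commute[of _ a])
  next
    case 3
    then show ?thesis by (rule power_mean_at_0_pos)
  qed
qed

text \<open>Reduces the three limit exponents to limits of real means; nontriviality of
  \<open>F\<close> makes the limit unique, so that \<open>Lim\<close> returns it.\<close>

lemma Lim_power_triangle_real:
  assumes "((\<lambda>p. power_mean p (d x z) (d z y)) \<longlongrightarrow> L) F" "F \<noteq> bot"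
    and "eventually (\<lambda>p. p \<noteq> 0) F"
    and "0 \<le> \<sigma>" "0 \<le> d x z" "0 \<le> d z y"
  shows "Lim F (\<lambda>p. power_triangle_real p \<sigma> x y z d) = ennreal (2 * \<sigma> * L)"
proof (rule tendsto_Lim[OF assms(2)])
  have "((\<lambda>p. ennreal (2 * \<sigma> * power_mean p (d x z) (d z y))) \<longlongrightarrow> ennreal (2 * \<sigma> * L)) F"
    using assms(1) by (intro tendsto_ennrealI tendsto_mult_left)
  moreover have "eventually (\<lambda>p. ennreal (2 * \<sigma> * power_mean p (d x z) (d z y))
      = power_triangle_real p \<sigma> x y z d) F"
    using assms(3) by eventually_elim (use assms(4-6) in \<open>simp add: power_triangle_real_eq\<close>)
  ultimately show "((\<lambda>p. power_triangle_real p \<sigma> x y z d) \<longlongrightarrow> ennreal (2 * \<sigma> * L)) F"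
    by (rule Lim_transform_eventually)
qed

text \<open>A zero number has reciprocal \<open>top\<close> in \<open>ennreal\<close>, so the right
  side is 0, in agreement with the convention in \<open>power_mean\<close>. Otherwise everything is
  finite and positive.\<close>

lemma harmonic_mean_ennreal:
  assumes "0 \<le> \<sigma>" "0 \<le> a" "0 \<le> b"
  shows "ennreal (2 * \<sigma> * power_mean (-1) a b)
    = ennreal (4 * \<sigma>) * inverse (1 / ennreal a + 1 / ennreal b)"
proof (cases "a = 0 \<or> b = 0")
  case True
  then show ?thesis
    by (auto simp: power_mean_def divide_ennreal_def)
next
  case False
  with assms have pos: "0 < a" "0 < b" by auto
  have "1 / ennreal a + 1 / ennreal b = ennreal (1 / a + 1 / b)"
    using pos divide_ennreal[of 1 a] divide_ennreal[of 1 b] by simp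
  moreover have "inverse (ennreal (1 / a + 1 / b)) = ennreal (inverse (1 / a + 1 / b))"
    using pos by (intro inverse_ennreal add_pos_pos) auto
  \<comment> \<open>Inverting the half sum yields the factor 2 that turns 2 * \<sigma> into 4 *
    \<sigma>.\<close>
  moreover have "power_mean (-1) a b = 2 * inverse (1 / a + 1 / b)"
    using pos by (simp add: power_mean_def powr_minus powr_add add_pos_pos field_simps)
  ultimately show ?thesis
    using assms by (simp add: ennreal_mult[symmetric])
qed

theorem corollary4p7:
  fixes X :: "'a set" and d :: "'a \<Rightarrow> 'a \<Rightarrow> real" and \<sigma> :: real and x y z :: 'a
  assumes "distance_space X d"
    and "\<sigma> > 0"
    and "x \<in> X" and "y \<in> X" and "z \<in> X"
  shows "power_triangle \<infinity> \<sigma> x y z d = ennreal (2 * \<sigma> * max (d x z) (d z y))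
    \<and> power_triangle 2 \<sigma> x y z d
        = ennreal (2 * \<sigma> * (1 / 2 * (d x z)\<^sup>2 + 1 / 2 * (d z y)\<^sup>2) powr (1 / 2))
    \<and> power_triangle 1 \<sigma> x y z d = ennreal (\<sigma> * (d x z + d z y))
    \<and> power_triangle 0 \<sigma> x y z d = ennreal (2 * \<sigma> * sqrt (d x z) * sqrt (d z y))
    \<and> power_triangle (-1) \<sigma> x y z d
        = ennreal (4 * \<sigma>) * inverse (1 / ennreal (d x z) + 1 / ennreal (d z y))
    \<and> power_triangle (-\<infinity>) \<sigma> x y z d = ennreal (2 * \<sigma> * min (d x z) (d z y))"
proof -
  let ?a = "d x z" and ?b = "d z y"
  have nn: "0 \<le> ?a" "0 \<le> ?b" and \<sigma>: "0 \<le> \<sigma>"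
    using assms by (auto intro: distance_space.nonneg)
  note Lim = Lim_power_triangle_real[where d = d and x = x and y = y and z = z,
      OF _ _ _ \<sigma> nn]
  \<comment> \<open>The exponents 2, 1 and -1 involve no limit, so evaluating
    \<open>power_mean\<close> suffices for them.\<close>
  have real: "power_triangle (ereal p) \<sigma> x y z d = ennreal (2 * \<sigma> * power_mean p ?a ?b)"
    if "p \<noteq> 0" for p
    using that nn \<sigma> by (simp add: power_triangle_def power_triangle_real_eq)
  have "power_triangle \<infinity> \<sigma> x y z d = ennreal (2 * \<sigma> * max ?a ?b)"
    by (simp add: power_triangle_def
        Lim[OF power_mean_at_top[OF nn] _ eventually_mono[OF eventually_gt_at_top[of 0]]])
  moreover have "power_triangle 2 \<sigma> x y z d
      = ennreal (2 * \<sigma> * (1 / 2 * ?a\<^sup>2 + 1 / 2 * ?b\<^sup>2) powr (1 / 2))"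
    using real[of 2] nn by (simp add: power_mean_def)
  moreover have "power_triangle 1 \<sigma> x y z d = ennreal (\<sigma> * (?a + ?b))"
    using real[of 1] nn by (simp add: power_mean_def one_ereal_def[symmetric] distrib_left)
  \<comment> \<open>The filter \<open>at 0\<close> leaves out 0 itself, so the exponents are
    eventually nonzero.\<close>
  moreover have "power_triangle 0 \<sigma> x y z d = ennreal (2 * \<sigma> * sqrt ?a * sqrt ?b)"
    using Lim[OF power_mean_at_0[OF nn]]
    unfolding power_triangle_def zero_ereal_def ereal.case
    by (simp add: eventually_at_filter mult.assoc)
  moreover have "power_triangle (-1) \<sigma> x y z d
      = ennreal (4 * \<sigma>) * inverse (1 / ennreal ?a + 1 / ennreal ?b)"
    using real[of "-1"] harmonic_mean_ennreal[OF \<sigma> nn] by (simp add: one_ereal_def[symmetric] flip: uminus_ereal.simps(1))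
  moreover have "power_triangle (-\<infinity>) \<sigma> x y z d = ennreal (2 * \<sigma> * min ?a ?b)"
    by (simp add: power_triangle_def
        Lim[OF power_mean_at_bot[OF nn] _ eventually_mono[OF eventually_gt_at_bot[of 0]]])
  ultimately show ?thesis by blast
qed

end
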